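(* Let $G$ be a finite simple planar graph with $\delta(G)\geq 2$ and $g(G)\geq 10$. Then $b_i(G)\leq 3$.
   Context: An independent dominating set of $G$ is a set $D\subseteq V(G)$ that is independent and such that every vertex not in $D$ has a neighbor in $D$. The independent domination number $\gamma_i(G)$ is the minimum size of an independent dominating set. The independent bondage number $b_i(G)$ is the minimum cardinality of an edge set $B\subseteq E(G)$ such that $\gamma_i(G-B)>\gamma_i(G)$, where $G-B$ is the graph on $V(G)$ with edge set $E(G)\setminus B$. $\delta(G)$ is the minimum degree and $g(G)$ the girth (length of a shortest cycle). *)

theory Defs
  imports "HOL-Analysis.Analysis" "HOL-Library.Extended_Nat"
begin

text \<open>A simple graph is given by its vertex set \<open>V\<close> and its set \<open>E\<close> of edges, each edge being
  an unordered pair of distinct vertices.\<close>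

definition simple_graph :: "'a set \<Rightarrow> 'a set set \<Rightarrow> bool" where
  "simple_graph V E \<longleftrightarrow> (\<forall>e\<in>E. e \<subseteq> V \<and> card e = 2)"

definition vertex_degree :: "'a set set \<Rightarrow> 'a \<Rightarrow> nat" where
  "vertex_degree E v = card {e \<in> E. v \<in> e}"

text \<open>Meaningful for finite nonempty \<open>V\<close> only.\<close>
definition min_degree :: "'a set \<Rightarrow> 'a set set \<Rightarrow> nat" where
  "min_degree V E = Min (vertex_degree E ` V)"

text \<open>A cycle is the list of its vertices in cyclic order, so that its number of edges is the
  length of the list.\<close>
definition is_cycle :: "'a set set \<Rightarrow> 'a list \<Rightarrow> bool" where
  "is_cycle E c \<longleftrightarrow> length c \<ge> 3 \<and> distinct c \<and>
     (\<forall>i < length c. {c ! i, c ! (Suc i mod length c)} \<in> E)"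

text \<open>The girth of an acyclic graph is \<open>\<infinity>\<close>.\<close>
definition girth :: "'a set set \<Rightarrow> enat" where
  "girth E = (INF c\<in>{c. is_cycle E c}. enat (length c))"

text \<open>Topological planarity: vertices are distinct points of the plane, edges are (continuous)
  arcs joining the points of their end vertices, an arc contains no further vertex, and two
  different arcs have no common point apart from vertices.\<close>
definition planar :: "'a set \<Rightarrow> 'a set set \<Rightarrow> bool" where
  "planar V E \<longleftrightarrow> (\<exists>(p :: 'a \<Rightarrow> complex) (\<gamma> :: 'a set \<Rightarrow> real \<Rightarrow> complex).
     inj_on p V \<and>
     (\<forall>e\<in>E. arc (\<gamma> e) \<and> {pathstart (\<gamma> e), pathfinish (\<gamma> e)} = p ` e \<and>
        path_image (\<gamma> e) \<inter> p ` V = p ` e) \<and>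
     (\<forall>e\<in>E. \<forall>f\<in>E. e \<noteq> f \<longrightarrow> path_image (\<gamma> e) \<inter> path_image (\<gamma> f) \<subseteq> p ` V))"

definition indep_dominating :: "'a set \<Rightarrow> 'a set set \<Rightarrow> 'a set \<Rightarrow> bool" where
  "indep_dominating V E D \<longleftrightarrow> D \<subseteq> V \<and> (\<forall>u\<in>D. \<forall>v\<in>D. {u, v} \<notin> E) \<and>
     (\<forall>v\<in>V - D. \<exists>u\<in>D. {u, v} \<in> E)"

text \<open>For a finite simple graph the minimum ranges over a finite nonempty set, because every maximal
  independent set is dominating.\<close>
definition indep_domination_number :: "'a set \<Rightarrow> 'a set set \<Rightarrow> nat" where
  "indep_domination_number V E = Min (card ` {D. indep_dominating V E D})"

text \<open>The value is \<open>\<infinity>\<close> if no set of edges has the required property, that is, if there are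
  no edges at all.\<close>
definition indep_bondage_number :: "'a set \<Rightarrow> 'a set set \<Rightarrow> enat" where
  "indep_bondage_number V E =
     (INF B\<in>{B. B \<subseteq> E \<and> indep_domination_number V (E - B) > indep_domination_number V E}.
        enat (card B))"

end

theory Submission
  imports Defs
begin

text \<open>
  Deleting the three edges incident with two adjacent vertices of degree 2 increases the independent
  domination number. So does deleting \<open>aw\<close>, \<open>ax\<close>, \<open>by\<close> when all neighbours \<open>a\<close>, \<open>b\<close>, \<open>c\<close> of a vertex
  \<open>w\<close> of degree 3 have degree 2, where \<open>x\<close> and \<open>y\<close> are the further neighbours of \<open>a\<close> and \<open>b\<close>. If neither
  configuration occurs, discharging gives \<open>4|E| \<ge> 5|V|\<close>.

  A plane graph of girth at least 10 has \<open>4|E| < 5|V|\<close>. Its faces are the components of the complement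
  of the drawing. By Janiszewski's theorem a forest has one face, and each further edge
  closing a cycle splits one face into its parts inside and outside the cycle, so the number of faces is
  \<open>1 + |E| - |M|\<close> for a maximal forest \<open>M\<close>. The boundary of each face contains a cycle (unless the
  graph is a forest), and an edge on a cycle bounds at most two faces.
\<close>

section \<open>Local configurations\<close>

lemma indep_dominating_exists:
  assumes "finite V" "simple_graph V E"
  shows "\<exists>D. indep_dominating V E D"
proof -
  define I where "I = {D. D \<subseteq> V \<and> (\<forall>u\<in>D. \<forall>v\<in>D. {u, v} \<notin> E)}"
  have "I \<subseteq> Pow V" "{} \<in> I" by (auto simp: I_def)
  then obtain D where D: "D \<in> I" and mx: "\<And>D'. D' \<in> I \<Longrightarrow> D \<subseteq> D' \<Longrightarrow> D = D'"
    using finite_has_maximal2[of I "{}"] assms(1) by (metis finite_Pow_iff finite_subset)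
  have "\<exists>u\<in>D. {u, v} \<in> E" if v: "v \<in> V - D" for v
  proof (rule ccontr)
    assume n: "\<not> (\<exists>u\<in>D. {u, v} \<in> E)"
    have "{v, v} \<notin> E" using assms(2) by (auto simp: simple_graph_def)
    with n have "insert v D \<in> I"
      using D v by (auto simp: I_def insert_commute)
    with mx v show False by blast
  qed
  with D show ?thesis by (auto simp: I_def indep_dominating_def)
qed

text \<open>Turns the bound into a surgery on sets: \<open>smaller\<close>, applied to a minimum
  independent dominating set for \<open>E - B\<close>, shows that removing \<open>B\<close> raises
  the minimum.\<close>

lemma indep_bondage_number_leI:
  assumes "finite V" "simple_graph V E" "B \<subseteq> E" "card B \<le> k"
    and smaller: "\<And>D. indep_dominating V (E - B) D \<Longrightarrow>
      \<exists>D'. indep_dominating V E D' \<and> card D' < card D"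
  shows "indep_bondage_number V E \<le> enat k"
proof -
  have fin: "finite (card ` {D. indep_dominating V F D})" for F
    by (rule finite_imageI, rule finite_subset[of _ "Pow V"])
       (use assms(1) in \<open>auto simp: indep_dominating_def\<close>)
  have "simple_graph V (E - B)" using assms(2) by (auto simp: simple_graph_def)
  then obtain D0 where "indep_dominating V (E - B) D0"
    using indep_dominating_exists assms(1) by blast
  then have "indep_domination_number V (E - B) \<in> card ` {D. indep_dominating V (E - B) D}"
    unfolding indep_domination_number_def by (intro Min_in fin) auto
  then obtain D where D: "indep_dominating V (E - B) D"
    "indep_domination_number V (E - B) = card D" by auto
  from smaller[OF D(1)] obtain D' where D': "indep_dominating V E D'" "card D' < card D" by blast
  have "indep_domination_number V E \<le> card D'"
    unfolding indep_domination_number_def by (intro Min_le fin) (use D'(1) in auto)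
  with D D' have "indep_domination_number V E < indep_domination_number V (E - B)" by simp
  then have "indep_bondage_number V E \<le> enat (card B)"
    unfolding indep_bondage_number_def by (intro INF_lower) (use assms(3) in auto)
  also have "\<dots> \<le> enat k" using assms(4) by simp
  finally show ?thesis .
qed

section \<open>Neighbourhoods of vertices of degree 2 and 3\<close>

lemma simple_graph_edgeD:
  assumes "simple_graph V E" "{u, v} \<in> E"
  shows "u \<noteq> v" "u \<in> V" "v \<in> V"
proof -
  have "{u, v} \<subseteq> V" "card {u, v} = 2" using assms unfolding simple_graph_def by blast+
  then show "u \<noteq> v" "u \<in> V" "v \<in> V" by auto
qed

lemma simple_graph_edgeE:
  assumes "simple_graph V E" "e \<in> E" "u \<in> e"
  obtains v where "e = {u, v}" "u \<noteq> v"
proof -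
  have "card e = 2" using assms by (auto simp: simple_graph_def)
  then show ?thesis using assms(3) that by (auto simp: card_2_iff)
qed

text \<open>The neighbourhood comes as an equivalence so that later goals
  \<open>{u, t} \<in> E\<close> reduce to equations between vertices.\<close>

lemma degree_two_neighbours:
  assumes "simple_graph V E" "vertex_degree E u = 2" "{u, v} \<in> E"
  obtains x where "x \<noteq> v" "{u, x} \<in> E" "\<And>y. {u, y} \<in> E \<longleftrightarrow> y = v \<or> y = x"
proof -
  from assms(2) obtain e f where ef: "{e \<in> E. u \<in> e} = {e, f}" "e \<noteq> f"
    by (auto simp: vertex_degree_def card_2_iff)
  have "{u, v} \<in> {e, f}" unfolding ef(1)[symmetric] using assms(3) by simp
  with ef have "\<exists>f. {e \<in> E. u \<in> e} = {{u, v}, f} \<and> f \<noteq> {u, v}"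
    by (metis insert_commute insert_iff singletonD)
  then obtain f where f: "{e \<in> E. u \<in> e} = {{u, v}, f}" "f \<noteq> {u, v}" by blast
  then have "f \<in> E" "u \<in> f" by auto
  with assms(1) obtain x where x: "f = {u, x}" by (metis simple_graph_edgeE)
  show ?thesis
  proof (rule that)
    show "x \<noteq> v" using f x by auto
    show "{u, x} \<in> E" using \<open>f \<in> E\<close> x by simp
    show "{u, y} \<in> E \<longleftrightarrow> y = v \<or> y = x" for y
    proof -
      have "{u, y} \<in> E \<longleftrightarrow> {u, y} \<in> {e \<in> E. u \<in> e}" by simp
      then show ?thesis unfolding f(1) x by (auto simp: doubleton_eq_iff)
    qed
  qed
qed

lemma degree_three_neighbours:
  assumes "simple_graph V E" "vertex_degree E w = 3"
  obtains a b c where "a \<noteq> b" "a \<noteq> c" "b \<noteq> c" "\<And>y. {w, y} \<in> E \<longleftrightarrow> y = a \<or> y = b \<or> y = c"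
proof -
  from assms(2) obtain e f g where efg: "{e \<in> E. w \<in> e} = {e, f, g}" "e \<noteq> f" "e \<noteq> g" "f \<noteq> g"
    by (auto simp: vertex_degree_def card_3_iff)
  then have "e \<in> E" "w \<in> e" "f \<in> E" "w \<in> f" "g \<in> E" "w \<in> g" by auto
  then obtain a b c where abc: "e = {w, a}" "f = {w, b}" "g = {w, c}"
    using assms(1) by (metis simple_graph_edgeE)
  show ?thesis
  proof (rule that)
    show "{w, y} \<in> E \<longleftrightarrow> y = a \<or> y = b \<or> y = c" for y
    proof -
      have "{w, y} \<in> E \<longleftrightarrow> {w, y} \<in> {e \<in> E. w \<in> e}" by simp
      then show ?thesis unfolding efg(1) abc by (auto simp: doubleton_eq_iff)
    qed
  qed (use efg abc in auto)
qed

text \<open>Removing all edges at \<open>u\<close> and \<open>v\<close> isolates both, so an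
  independent dominating set of the rest contains both. In the original graph they are adjacent, and
  at least one of them is dispensable.\<close>

lemma indep_bondage_number_le_adjacent_degree_two:
  assumes fin: "finite V" and G: "simple_graph V E" and uv: "{u, v} \<in> E"
    and du: "vertex_degree E u = 2" and dv: "vertex_degree E v = 2"
  shows "indep_bondage_number V E \<le> 3"
proof -
  obtain x where x: "x \<noteq> v" "{u, x} \<in> E" and nu: "\<And>y. {u, y} \<in> E \<longleftrightarrow> y = v \<or> y = x"
    using degree_two_neighbours[OF G du uv] by metis
  have vu: "{v, u} \<in> E" using uv by (simp add: insert_commute)
  obtain y where y: "y \<noteq> u" "{v, y} \<in> E" and nv: "\<And>z. {v, z} \<in> E \<longleftrightarrow> z = u \<or> z = y"
    using degree_two_neighbours[OF G dv vu] by metis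
  note ne = simple_graph_edgeD[OF G uv] simple_graph_edgeD[OF G x(2)] simple_graph_edgeD[OF G y(2)]
  have nu': "\<And>z. {z, u} \<in> E \<longleftrightarrow> z = v \<or> z = x" using nu by (simp add: insert_commute)
  have nv': "\<And>z. {z, v} \<in> E \<longleftrightarrow> z = u \<or> z = y" using nv by (simp add: insert_commute)
  define B where "B = {{u, v}, {u, x}, {v, y}}"
  have EB: "{s, t} \<in> E - B \<longleftrightarrow> {s, t} \<in> E \<and> s \<noteq> u \<and> s \<noteq> v \<and> t \<noteq> u \<and> t \<noteq> v" for s t
    using nu[of t] nv[of t] nu'[of s] nv'[of s] by (auto simp: B_def doubleton_eq_iff)
  have "indep_bondage_number V E \<le> enat 3"
  proof (rule indep_bondage_number_leI[OF fin G])
    show "B \<subseteq> E" using uv x y by (auto simp: B_def)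
    show "card B \<le> 3" by (auto simp: B_def card_insert_if)
    fix D assume D: "indep_dominating V (E - B) D"
    then have DV: "D \<subseteq> V" and ind: "\<And>s t. s \<in> D \<Longrightarrow> t \<in> D \<Longrightarrow> {s, t} \<notin> E - B"
      and dom: "\<And>t. t \<in> V \<Longrightarrow> t \<notin> D \<Longrightarrow> \<exists>s\<in>D. {s, t} \<in> E - B"
      by (auto simp: indep_dominating_def)
    have finD: "finite D" using DV fin finite_subset by blast
    have uD: "u \<in> D" "v \<in> D" using dom[of u] dom[of v] ne unfolding EB by auto
    \<comment> \<open>A vertex is dropped only if it stays dominated: \<open>v\<close> by
      \<open>u\<close> when \<open>x\<close> is absent, \<open>u\<close> by \<open>v\<close> when
      \<open>y\<close> is absent, and otherwise \<open>u\<close> by \<open>x\<close> and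
      \<open>v\<close> by \<open>y\<close>.\<close>
    define D' where "D' = (if x \<notin> D then D - {v} else if y \<notin> D then D - {u} else D - {u, v})"
    have "D' \<subset> D" using uD by (auto simp: D'_def)
    then have "card D' < card D" using finD by (rule psubset_card_mono[rotated])
    moreover have "indep_dominating V E D'"
      unfolding indep_dominating_def
    proof (intro conjI ballI)
      show "D' \<subseteq> V" using DV by (auto simp: D'_def)
      show "{s, t} \<notin> E" if "s \<in> D'" "t \<in> D'" for s t
        using that ind[of s t] unfolding EB
        using nu[of t] nv[of t] nu'[of s] nv'[of s] ne by (auto simp: D'_def split: if_splits)
      show "\<exists>s\<in>D'. {s, t} \<in> E" if t: "t \<in> V - D'" for t
      proof (cases "t = u \<or> t = v")
        case True
        have "x \<in> D - {u, v}" if "x \<in> D" using that ne x by auto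
        moreover have "y \<in> D - {u, v}" if "y \<in> D" using that ne y by auto
        ultimately show ?thesis
          using True t uD uv nu'[of x] nv'[of y] ne nv'[of u] nu'[of v]
          by (auto simp: D'_def split: if_splits)
      next
        case False
        then have "t \<notin> D" using t by (auto simp: D'_def split: if_splits)
        with dom[of t] t obtain s where "s \<in> D" "{s, t} \<in> E" "s \<noteq> u" "s \<noteq> v"
          unfolding EB by auto
        then show ?thesis by (auto simp: D'_def)
      qed
    qed
    ultimately show "\<exists>D'. indep_dominating V E D' \<and> card D' < card D" by blast
  qed
  then show ?thesis by (simp add: numeral_eq_enat)
qed

text \<open>Without \<open>aw\<close>, \<open>ax\<close>, \<open>by\<close> the vertex
  \<open>a\<close> is isolated and \<open>b\<close> hangs on \<open>w\<close> alone, which forces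
  \<open>a\<close> and exactly one of \<open>b\<close>, \<open>w\<close> into \<open>D\<close>. Once
  the edges are back, a local exchange around \<open>w\<close> saves a vertex.\<close>

lemma indep_bondage_number_le_degree_three:
  assumes fin: "finite V" and G: "simple_graph V E" and dw: "vertex_degree E w = 3"
    and nb: "\<And>u. {w, u} \<in> E \<Longrightarrow> vertex_degree E u = 2"
    and no: "\<And>u v. {u, v} \<in> E \<Longrightarrow> vertex_degree E u = 2 \<Longrightarrow> vertex_degree E v \<noteq> 2"
  shows "indep_bondage_number V E \<le> 3"
proof -
  obtain a b c where abc: "a \<noteq> b" "a \<noteq> c" "b \<noteq> c"
    and nw: "\<And>y. {w, y} \<in> E \<longleftrightarrow> y = a \<or> y = b \<or> y = c"
    using degree_three_neighbours[OF G dw] by metis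
  have wE: "{a, w} \<in> E" "{b, w} \<in> E" "{c, w} \<in> E" using nw by (auto simp: insert_commute)
  have d2: "vertex_degree E a = 2" "vertex_degree E b = 2" "vertex_degree E c = 2"
    using nb nw by auto
  obtain x where x: "x \<noteq> w" "{a, x} \<in> E" and na: "\<And>t. {a, t} \<in> E \<longleftrightarrow> t = w \<or> t = x"
    using degree_two_neighbours[OF G d2(1) wE(1)] by metis
  obtain y where y: "y \<noteq> w" "{b, y} \<in> E" and nb: "\<And>t. {b, t} \<in> E \<longleftrightarrow> t = w \<or> t = y"
    using degree_two_neighbours[OF G d2(2) wE(2)] by metis
  obtain z where z: "z \<noteq> w" "{c, z} \<in> E" and nc: "\<And>t. {c, t} \<in> E \<longleftrightarrow> t = w \<or> t = z"
    using degree_two_neighbours[OF G d2(3) wE(3)] by metis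
  note ne = simple_graph_edgeD[OF G wE(1)] simple_graph_edgeD[OF G wE(2)] simple_graph_edgeD[OF G wE(3)]
    simple_graph_edgeD[OF G x(2)] simple_graph_edgeD[OF G y(2)] simple_graph_edgeD[OF G z(2)]
  \<comment> \<open>No two vertices of degree 2 are adjacent, so the outer neighbours avoid
    \<open>{a, b, c}\<close>. They may coincide with each other.\<close>
  have far: "x \<notin> {a, b, c}" "y \<notin> {a, b, c}" "z \<notin> {a, b, c}"
    using no[OF x(2)] no[OF y(2)] no[OF z(2)] d2 by auto
  have nw': "\<And>t. {t, w} \<in> E \<longleftrightarrow> t = a \<or> t = b \<or> t = c" using nw by (simp add: insert_commute)
  have na': "\<And>t. {t, a} \<in> E \<longleftrightarrow> t = w \<or> t = x" using na by (simp add: insert_commute)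
  have nb': "\<And>t. {t, b} \<in> E \<longleftrightarrow> t = w \<or> t = y" using nb by (simp add: insert_commute)
  have nc': "\<And>t. {t, c} \<in> E \<longleftrightarrow> t = w \<or> t = z" using nc by (simp add: insert_commute)
  define B where "B = {{a, w}, {a, x}, {b, y}}"
  have EB: "{s, t} \<in> E - B \<longleftrightarrow> {s, t} \<in> E \<and> s \<noteq> a \<and> t \<noteq> a \<and> (s = b \<longrightarrow> t = w) \<and> (t = b \<longrightarrow> s = w)" for s t
    using na[of t] nb[of t] na'[of s] nb'[of s] ne abc far x y
    by (auto simp: B_def doubleton_eq_iff)
  have "indep_bondage_number V E \<le> enat 3"
  proof (rule indep_bondage_number_leI[OF fin G])
    show "B \<subseteq> E" using wE x y by (auto simp: B_def)
    show "card B \<le> 3" by (auto simp: B_def card_insert_if)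
    fix D assume D: "indep_dominating V (E - B) D"
    then have DV: "D \<subseteq> V" and ind: "\<And>s t. s \<in> D \<Longrightarrow> t \<in> D \<Longrightarrow> {s, t} \<notin> E - B"
      and dom: "\<And>t. t \<in> V \<Longrightarrow> t \<notin> D \<Longrightarrow> \<exists>s\<in>D. {s, t} \<in> E - B"
      by (auto simp: indep_dominating_def)
    have finD: "finite D" using DV fin finite_subset by blast
    have aD: "a \<in> D" using dom[of a] ne unfolding EB by auto
    have wb: "w \<in> D \<longleftrightarrow> b \<notin> D" using dom[of b] ind[of b w] ne wE abc unfolding EB by auto
    have wc: "c \<notin> D" if "w \<in> D" using ind[of c w] that abc ne wE unfolding EB by auto
    have zc: "c \<notin> D" if "z \<in> D" using ind[of c z] that abc ne z far unfolding EB by auto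
    \<comment> \<open>The only edge of \<open>E - B\<close> meeting \<open>a\<close> or
      \<open>b\<close> is \<open>bw\<close>. Hence independence outside \<open>{a, b}\<close> is the
      same in both graphs, and among the vertices outside \<open>D\<close> only \<open>w\<close> can
      rely on \<open>a\<close> or \<open>b\<close>.\<close>
    have ind': "{s, t} \<notin> E" if "s \<in> D - {a, b}" "t \<in> D - {a, b}" for s t
      using that ind[of s t] unfolding EB by auto
    have dom': "\<exists>s\<in>D - {a, b}. {s, t} \<in> E" if "t \<in> V - D" "t \<noteq> w" for t
      using dom[of t] that unfolding EB by blast
    consider (w) "w \<in> D" | (c) "w \<notin> D" "c \<notin> D" | (x) "w \<notin> D" "c \<in> D" "x \<in> D"
      | (y) "w \<notin> D" "c \<in> D" "x \<notin> D" "y \<in> D" | (none) "w \<notin> D" "c \<in> D" "x \<notin> D" "y \<notin> D"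
      by blast
    then show "\<exists>D'. indep_dominating V E D' \<and> card D' < card D"
    proof cases
      case w
      have "indep_dominating V E (D - {a})"
        unfolding indep_dominating_def
      proof (intro conjI ballI)
        show "{s, t} \<notin> E" if "s \<in> D - {a}" "t \<in> D - {a}" for s t
          using ind'[of s t] that w wb by auto
        show "\<exists>s\<in>D - {a}. {s, t} \<in> E" if "t \<in> V - (D - {a})" for t
        proof (cases "t = a")
          case True then show ?thesis using w ne na'[of w] by auto
        next
          case False then show ?thesis using dom'[of t] that w by auto
        qed
      qed (use DV in auto)
      moreover have "card (D - {a}) < card D" using finD aD by (rule card_Diff1_less)
      ultimately show ?thesis by blast
    next
      case c
      let ?D' = "insert w (D - {a, b})"
      have "indep_dominating V E ?D'"
        unfolding indep_dominating_def
      proof (intro conjI ballI)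
        show "{s, t} \<notin> E" if "s \<in> ?D'" "t \<in> ?D'" for s t
          using ind'[of s t] that c nw[of t] nw'[of s] ne by auto
        show "\<exists>s\<in>?D'. {s, t} \<in> E" if "t \<in> V - ?D'" for t
        proof (cases "t = a \<or> t = b")
          case True then show ?thesis using na'[of w] nb'[of w] by auto
        next
          case False then show ?thesis using dom'[of t] that by auto
        qed
      qed (use DV ne in auto)
      moreover have "card ?D' < card D"
      proof -
        have "{a, b} \<subseteq> D" using aD wb c by auto
        then have "card (D - {a, b}) = card D - 2" "2 \<le> card D"
          using abc finD card_mono[of D "{a, b}"] by (auto simp: card_Diff_subset)
        moreover have "card ?D' = Suc (card (D - {a, b}))" using c finD by simp
        ultimately show ?thesis by linarith
      qed
      ultimately show ?thesis by blast
    next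
      case x
      let ?D' = "if y \<in> D then D - {a, b} else D - {a}"
      have "indep_dominating V E ?D'"
        unfolding indep_dominating_def
      proof (intro conjI ballI)
        show "{s, t} \<notin> E" if "s \<in> ?D'" "t \<in> ?D'" for s t
          using ind'[of s t] that x nb[of t] nb'[of s] ne by (auto split: if_splits)
        show "\<exists>s\<in>?D'. {s, t} \<in> E" if "t \<in> V - ?D'" for t
        proof (cases "t = a \<or> t = b \<or> t = w")
          case True
          have "x \<in> ?D'" "c \<in> ?D'" "y \<in> D \<Longrightarrow> y \<in> ?D'" using x far abc by auto
          moreover have "{x, a} \<in> E" "{c, w} \<in> E" "{y, b} \<in> E" using na' nb' wE by auto
          ultimately show ?thesis using True that x wb by (auto split: if_splits)
        next
          case False then show ?thesis using dom'[of t] that by (auto split: if_splits)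
        qed
      qed (use DV in auto)
      moreover have "card ?D' < card D" using aD finD by (intro psubset_card_mono) auto
      ultimately show ?thesis by blast
    next
      case y
      have "indep_dominating V E (D - {b})"
        unfolding indep_dominating_def
      proof (intro conjI ballI)
        show "{s, t} \<notin> E" if "s \<in> D - {b}" "t \<in> D - {b}" for s t
          using ind'[of s t] that y na[of t] na'[of s] ne by auto
        show "\<exists>s\<in>D - {b}. {s, t} \<in> E" if "t \<in> V - (D - {b})" for t
        proof (cases "t = b \<or> t = w")
          case True
          have "y \<in> D - {b}" "c \<in> D - {b}" using y far abc by auto
          moreover have "{c, w} \<in> E" "{y, b} \<in> E" using nb' wE by auto
          ultimately show ?thesis using True by auto
        next
          case False then show ?thesis using dom'[of t] that by auto
        qed
      qed (use DV in auto)
      moreover have "card (D - {b}) < card D" using finD y wb by (intro card_Diff1_less) auto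
      ultimately show ?thesis by blast
    next
      case none
      \<comment> \<open>Neither \<open>x\<close> nor \<open>y\<close> is dominated through a removed edge, so trading \<open>a, b, c\<close> for \<open>w\<close>
        can leave only \<open>z\<close> undominated.\<close>
      define R where "R = D - {a, b, c}"
      define D' where "D' = insert w (if \<exists>s\<in>R. {s, z} \<in> E then R else insert z R)"
      have zD: "z \<notin> D" using zc none by auto
      have "indep_dominating V E D'"
        unfolding indep_dominating_def
      proof (intro conjI ballI)
        have z': "{z, t} \<in> E \<longleftrightarrow> {t, z} \<in> E" for t by (simp add: insert_commute)
        have zz: "{z, z} \<notin> E" using simple_graph_edgeD(1)[OF G] by blast
        show "{s, t} \<notin> E" if "s \<in> D'" "t \<in> D'" for s t
          using ind'[of s t] that nw[of t] nw'[of s] ne far z'[of t] zz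
          by (auto simp: D'_def R_def split: if_splits)
        show "\<exists>s\<in>D'. {s, t} \<in> E" if t: "t \<in> V - D'" for t
        proof (cases "t = a \<or> t = b \<or> t = c \<or> t = z")
          case True
          have "{w, a} \<in> E" "{w, b} \<in> E" "{w, c} \<in> E" using nw by auto
          then show ?thesis using True t by (auto simp: D'_def split: if_splits)
        next
          case False
          then have "t \<in> V - D" "t \<noteq> w" using t by (auto simp: D'_def R_def split: if_splits)
          then obtain s where "s \<in> D - {a, b}" "{s, t} \<in> E" using dom' by blast
          moreover from this False \<open>t \<noteq> w\<close> have "s \<noteq> c" using nc[of t] by auto
          ultimately show ?thesis by (auto simp: D'_def R_def)
        qed
      qed (use DV ne in \<open>auto simp: D'_def R_def\<close>)
      moreover have "card D' < card D"
      proof -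
        have sub: "{a, b, c} \<subseteq> D" using aD wb none by auto
        have "card {a, b, c} = 3" using abc by auto
        with sub have "card R = card D - 3" "3 \<le> card D"
          using finD card_mono[of D "{a, b, c}"] by (auto simp: card_Diff_subset R_def)
        moreover have "card D' \<le> Suc (Suc (card R))" using finD by (auto simp: D'_def R_def card_insert_if)
        ultimately show ?thesis by linarith
      qed
      ultimately show ?thesis by blast
    qed
  qed
  then show ?thesis by (simp add: numeral_eq_enat)
qed

text \<open>Sparsity says that the average degree is below 5/2. If every vertex of degree 3 had a
  neighbour of degree other than 2, charging would give
  \<open>10 * card V \<le> 8 * card E\<close>.\<close>

lemma sparse_reducible_configuration:
  assumes fin: "finite V" and G: "simple_graph V E"
    and deg: "\<And>v. v \<in> V \<Longrightarrow> vertex_degree E v \<ge> 2"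
    and sparse: "4 * card E < 5 * card V"
    and no: "\<And>u v. {u, v} \<in> E \<Longrightarrow> vertex_degree E u = 2 \<Longrightarrow> vertex_degree E v \<noteq> 2"
  shows "\<exists>w. vertex_degree E w = 3 \<and> (\<forall>u. {w, u} \<in> E \<longrightarrow> vertex_degree E u = 2)"
proof (rule ccontr)
  assume contra: "\<not> ?thesis"
  \<comment> \<open>Discharging: every edge gives 4 to each end, except that it gives 5 and 3 to its ends of
    degree 2 and at least 3 respectively; every vertex then receives at least 10.\<close>
  define ch :: "'a \<Rightarrow> 'a set \<Rightarrow> nat" where
    "ch v e = (if vertex_degree E v = 2 then 5 else if \<exists>u\<in>e. vertex_degree E u = 2 then 3 else 4)" for v e
  have "E \<subseteq> Pow V" using G by (auto simp: simple_graph_def)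
  then have finE: "finite E" using fin by (meson finite_Pow_iff finite_subset)
  \<comment> \<open>The two ends never both have degree 2, so an edge pays 4 + 4 or 5 + 3.\<close>
  have edge: "(\<Sum>v\<in>{v \<in> V. v \<in> e}. ch v e) \<le> 8" if "e \<in> E" for e
  proof -
    have "card e = 2" "e \<subseteq> V" using G that by (auto simp: simple_graph_def)
    then obtain u v where e: "e = {u, v}" "u \<noteq> v" by (auto simp: card_2_iff)
    have "{v \<in> V. v \<in> e} = {u, v}" using \<open>e \<subseteq> V\<close> e by auto
    then show ?thesis using no[of u v] that e by (auto simp: ch_def)
  qed
  \<comment> \<open>The income is 5 + 5 for degree 2, at least 4 + 3 + 3 for degree 3, where the 4
    comes along the edge to the neighbour of degree other than 2, and at least 4 * 3 from degree 4
    on.\<close>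
  have vertex: "10 \<le> (\<Sum>e\<in>{e \<in> E. v \<in> e}. ch v e)" if v: "v \<in> V" for v
  proof -
    let ?I = "{e \<in> E. v \<in> e}"
    have cI: "card ?I = vertex_degree E v" by (simp add: vertex_degree_def)
    have fI: "finite ?I" using finE by simp
    consider "vertex_degree E v = 2" | "vertex_degree E v = 3" | "vertex_degree E v \<ge> 4"
      using deg[OF v] by linarith
    then show ?thesis
    proof cases
      case 1
      then show ?thesis using cI by (simp add: ch_def)
    next
      case 2
      with contra obtain u where u: "{v, u} \<in> E" "vertex_degree E u \<noteq> 2" by blast
      let ?e = "{v, u}"
      have e: "?e \<in> ?I" "ch v ?e = 4" using u 2 by (auto simp: ch_def)
      have "3 * card (?I - {?e}) \<le> (\<Sum>e\<in>?I - {?e}. ch v e)"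
        using sum_bounded_below[of "?I - {?e}" 3 "ch v"] 2 by (simp add: ch_def mult.commute)
      moreover have "card (?I - {?e}) = 2" using e fI cI 2 by simp
      ultimately show ?thesis using sum.remove[OF fI e(1), of "ch v"] e(2) by simp
    next
      case 3
      have "3 * card ?I \<le> (\<Sum>e\<in>?I. ch v e)"
        using sum_bounded_below[of ?I 3 "ch v"] 3 by (simp add: ch_def mult.commute)
      then show ?thesis using cI 3 by simp
    qed
  qed
  have "10 * card V \<le> (\<Sum>v\<in>V. \<Sum>e\<in>{e \<in> E. v \<in> e}. ch v e)"
    using sum_mono[OF vertex] by (simp add: mult.commute)
  also have "\<dots> = (\<Sum>e\<in>E. \<Sum>v\<in>{v \<in> V. v \<in> e}. ch v e)"
    by (rule sum.swap_restrict[OF fin finE])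
  also have "\<dots> \<le> 8 * card E" using sum_mono[OF edge] by (simp add: mult.commute)
  finally show False using sparse by simp
qed

section \<open>Paths, cycles and forests\<close>

definition graph_path :: "'a set set \<Rightarrow> 'a list \<Rightarrow> bool" where
  "graph_path H xs \<longleftrightarrow> distinct xs \<and> successively (\<lambda>x y. {x, y} \<in> H) xs"

lemma successively_iff_nth:
  "successively P xs \<longleftrightarrow> (\<forall>i. Suc i < length xs \<longrightarrow> P (xs ! i) (xs ! Suc i))"
proof (induction xs rule: induct_list012)
  case (3 x y zs)
  show ?case using "3.IH"(2) by (auto simp: nth_Cons' less_Suc_eq_0_disj) 
qed auto

lemma graph_path_mono: "graph_path H xs \<Longrightarrow> H \<subseteq> K \<Longrightarrow> graph_path K xs"
  unfolding graph_path_def successively_iff_nth by blast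

lemma is_cycle_mono: "is_cycle H c \<Longrightarrow> H \<subseteq> K \<Longrightarrow> is_cycle K c"
  unfolding is_cycle_def by blast

text \<open>Trades the modular indices for a path with a closing edge, the form in which cycles are
  found in the longest-path argument.\<close>

lemma is_cycle_iff_graph_path:
  "is_cycle H c \<longleftrightarrow> length c \<ge> 3 \<and> graph_path H c \<and> {last c, hd c} \<in> H"
proof -
  have "(\<forall>i<length c. {c ! i, c ! (Suc i mod length c)} \<in> H) \<longleftrightarrow>
      (\<forall>i. Suc i < length c \<longrightarrow> {c ! i, c ! Suc i} \<in> H) \<and> {last c, hd c} \<in> H"
    if "length c \<ge> 3"
  proof -
    have "i < length c \<longleftrightarrow> Suc i < length c \<or> i = length c - 1" for i using that by linarith
    moreover have "{c ! i, c ! (Suc i mod length c)} = {c ! i, c ! Suc i}" if "Suc i < length c" for i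
      using that by simp
    moreover have "{c ! (length c - 1), c ! (Suc (length c - 1) mod length c)} = {last c, hd c}"
    proof -
      have "c \<noteq> []" "Suc (length c - 1) = length c" using that by auto
      then show ?thesis by (simp add: last_conv_nth hd_conv_nth)
    qed
    ultimately show ?thesis by metis
  qed
  then show ?thesis unfolding is_cycle_def graph_path_def successively_iff_nth by blast
qed

text \<open>Rotating the list to start just after position \<open>i\<close> puts the removed edge
  between the last and the first entry, so the list itself runs along the rest of the cycle.\<close>

lemma cycle_edge_bypass:
  assumes c: "is_cycle H c" and i: "i < length c"
  shows "\<exists>xs. graph_path (H - {{c ! i, c ! (Suc i mod length c)}}) xs \<and> length xs \<ge> 2 \<and>
    {c ! i, c ! (Suc i mod length c)} = {hd xs, last xs}"
proof (intro exI conjI)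
  let ?n = "length c" and ?xs = "rotate (Suc i) c"
  have n: "?n \<ge> 3" and dist: "distinct c"
    and ed: "\<And>j. j < ?n \<Longrightarrow> {c ! j, c ! (Suc j mod ?n)} \<in> H" using c by (auto simp: is_cycle_def)
  have ne: "c \<noteq> []" using n by auto
  have nth: "?xs ! j = c ! ((Suc i + j) mod ?n)" if "j < ?n" for j using that by (rule nth_rotate)
  have hd: "hd ?xs = c ! (Suc i mod ?n)" using ne by (rule hd_rotate_conv_nth)
  have last: "last ?xs = c ! i"
    using nth[of "?n - 1"] ne i n by (simp add: last_conv_nth del: rotate_Suc)
  show "{c ! i, c ! (Suc i mod ?n)} = {hd ?xs, last ?xs}" unfolding hd last by blast
  show "length ?xs \<ge> 2" using n by simp
  have "{?xs ! j, ?xs ! Suc j} \<in> H - {{c ! i, c ! (Suc i mod ?n)}}" if j: "Suc j < ?n" for j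
  proof -
    let ?k = "(Suc i + j) mod ?n"
    have k: "?k < ?n" using ne by simp
    have sk: "(Suc i + Suc j) mod ?n = Suc ?k mod ?n" by (simp add: mod_Suc_eq)
    have eq: "{?xs ! j, ?xs ! Suc j} = {c ! ?k, c ! (Suc ?k mod ?n)}"
      using nth[of j] nth[of "Suc j"] j unfolding sk by simp
    have ki: "?k \<noteq> i" 
    proof
      assume "?k = i"
      moreover have "?k = (if Suc i + j < ?n then Suc i + j else Suc i + j - ?n)"
        using i j by (auto simp: le_mod_geq)
      ultimately show False using i j by (auto split: if_splits)
    qed
    have "{c ! ?k, c ! (Suc ?k mod ?n)} \<noteq> {c ! i, c ! (Suc i mod ?n)}"
    proof
      assume "{c ! ?k, c ! (Suc ?k mod ?n)} = {c ! i, c ! (Suc i mod ?n)}"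
      moreover have "c ! ?k \<noteq> c ! i" using ki dist k i by (simp add: nth_eq_iff_index_eq)
      ultimately have "c ! ?k = c ! (Suc i mod ?n)" "c ! (Suc ?k mod ?n) = c ! i"
        by (auto simp: doubleton_eq_iff)
      then have "?k = Suc i mod ?n" "Suc ?k mod ?n = i"
        using dist k i ne by (auto simp: nth_eq_iff_index_eq)
      \<comment> \<open>Two edges at different positions could agree only if \<open>i + 2\<close>
        were congruent to \<open>i\<close> modulo the length, which is at least 3.\<close>
      then show False using n i by (auto simp: mod_Suc split: if_splits)
    qed
    with eq ed[OF k] show ?thesis by simp
  qed
  then show "graph_path (H - {{c ! i, c ! (Suc i mod ?n)}}) ?xs"
    using dist unfolding graph_path_def successively_iff_nth by simp
qed

lemma card_cycle_edges:
  assumes c: "is_cycle H c"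
  shows "card ((\<lambda>i. {c ! i, c ! (Suc i mod length c)}) ` {..<length c}) = length c"
proof -
  have "inj_on (\<lambda>i. {c ! i, c ! (Suc i mod length c)}) {..<length c}"
  proof (rule inj_onI)
    fix i j assume ij: "i \<in> {..<length c}" "j \<in> {..<length c}"
      and eq: "{c ! i, c ! (Suc i mod length c)} = {c ! j, c ! (Suc j mod length c)}"
    have n: "length c \<ge> 3" "distinct c" "c \<noteq> []" using c by (auto simp: is_cycle_def)
    show "i = j"
    proof (rule ccontr)
      assume "i \<noteq> j"
      then have "c ! i \<noteq> c ! j" using ij n by (simp add: nth_eq_iff_index_eq)
      then have "c ! i = c ! (Suc j mod length c)" "c ! (Suc i mod length c) = c ! j"
        using eq by (auto simp: doubleton_eq_iff)
      then have "i = Suc j mod length c" "Suc i mod length c = j"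
        using ij n by (auto simp: nth_eq_iff_index_eq)
      then show False using n ij by (auto simp: mod_Suc split: if_splits)
    qed
  qed
  then show ?thesis by (simp add: card_image)
qed

text \<open>The first vertex of a longest path is a leaf: a further neighbour off the path would
  extend it, and one on the path would close a cycle.\<close>

lemma acyclic_has_leaf:
  assumes fin: "finite V" and G: "simple_graph V H" and ne: "H \<noteq> {}"
    and acyc: "\<nexists>c. is_cycle H c"
  shows "\<exists>v e. {f \<in> H. v \<in> f} = {e}"
proof -
  define P where "P n \<longleftrightarrow> (\<exists>xs. graph_path H xs \<and> length xs = n \<and> n \<ge> 2)" for n
  \<comment> \<open>The length bound matters: a one-vertex list is a path even if its vertex lies
    outside \<open>V\<close>.\<close>
  have sub: "set xs \<subseteq> V" if xs: "graph_path H xs" "length xs \<ge> 2" for xs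
  proof
    fix x assume "x \<in> set xs"
    then obtain i where i: "i < length xs" "x = xs ! i" by (auto simp: in_set_conv_nth)
    have e: "\<And>i. Suc i < length xs \<Longrightarrow> {xs ! i, xs ! Suc i} \<in> H"
      using xs by (auto simp: graph_path_def successively_iff_nth)
    have "\<exists>f\<in>H. x \<in> f"
    proof (cases i)
      case 0 then show ?thesis using e[of 0] i xs by (intro bexI[of _ "{xs ! 0, xs ! Suc 0}"]) auto
    next
      case (Suc j) then show ?thesis using e[of j] i by (intro bexI[of _ "{xs ! j, xs ! Suc j}"]) auto
    qed
    then show "x \<in> V" using G by (auto simp: simple_graph_def)
  qed
  have bound: "n \<le> card V" if "P n" for n
  proof -
    from that obtain xs where xs: "graph_path H xs" "length xs = n" "n \<ge> 2" by (auto simp: P_def)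
    then have "card (set xs) \<le> card V" using sub[of xs] fin by (intro card_mono) auto
    then show ?thesis using xs by (simp add: graph_path_def distinct_card)
  qed
  from ne obtain e where e: "e \<in> H" by blast
  then have "card e = 2" using G by (auto simp: simple_graph_def)
  then obtain a b where "e = {a, b}" "a \<noteq> b" by (auto simp: card_2_iff)
  then have "P 2" using e unfolding P_def by (intro exI[of _ "[a, b]"]) (auto simp: graph_path_def)
  with bound obtain n where n: "P n" "\<And>m. P m \<Longrightarrow> m \<le> n" by (metis GreatestI_nat Greatest_le_nat)
  then obtain xs where xs: "graph_path H xs" "length xs = n" "n \<ge> 2" by (auto simp: P_def)
  then obtain v w ys where v: "xs = v # w # ys" by (metis Suc_le_length_iff numeral_2_eq_2)
  have vw: "{v, w} \<in> H" using xs v by (auto simp: graph_path_def)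
  have "f = {v, w}" if f: "f \<in> H" "v \<in> f" for f
  proof (rule ccontr)
    assume fn: "f \<noteq> {v, w}"
    have "card f = 2" using G f by (auto simp: simple_graph_def)
    then obtain u where u: "f = {v, u}" "u \<noteq> v" using f(2) by (auto simp: card_2_iff)
    then have uw: "u \<noteq> w" using fn by auto
    have "u \<in> set xs"
    proof (rule ccontr)
      assume "u \<notin> set xs"
      then have "graph_path H (u # xs)" using xs v f u by (auto simp: graph_path_def insert_commute)
      then have "P (Suc n)" unfolding P_def using xs by (intro exI[of _ "u # xs"]) auto
      then show False using n(2) by force
    qed
    with v u uw have "u \<in> set ys" by auto
    \<comment> \<open>The initial segment of the path up to \<open>u\<close>, closed by the edge
      from \<open>u\<close> back to \<open>v\<close>, is a cycle; \<open>w\<close> lies strictly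
      between, so it has at least three vertices.\<close>
    then obtain as bs where ys: "ys = as @ u # bs" by (meson split_list)
    define c where "c = v # w # as @ [u]"
    have "xs = c @ bs" by (simp add: c_def v ys)
    then have "graph_path H c" using xs by (auto simp: graph_path_def successively_append_iff)
    then have "is_cycle H c"
      unfolding is_cycle_iff_graph_path using f u by (auto simp: c_def insert_commute)
    then show False using acyc by blast
  qed
  then have "{f \<in> H. v \<in> f} = {{v, w}}" using vw by blast
  then show ?thesis by blast
qed

text \<open>Induction on the number of vertices, deleting a leaf together with its only edge. The
  other end of that edge keeps the vertex set nonempty.\<close>

lemma card_edges_acyclic_less:
  assumes "finite V" "V \<noteq> {}" "simple_graph V H" "\<nexists>c. is_cycle H c"
  shows "card H < card V"
  using assms
proof (induction "card V" arbitrary: V H rule: less_induct)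
  case less
  show ?case
  proof (cases "H = {}")
    case True then show ?thesis using less.prems by (simp add: card_gt_0_iff)
  next
    case False
    then obtain v e where ve: "{f \<in> H. v \<in> f} = {e}" using acyclic_has_leaf less.prems by metis
    then have e: "e \<in> H" "v \<in> e" by auto
    have e2: "e \<subseteq> V" "card e = 2" using e less.prems by (auto simp: simple_graph_def)
    have v: "v \<in> V" using e e2 by auto
    have ne: "V - {v} \<noteq> {}"
    proof
      assume "V - {v} = {}"
      then have "e \<subseteq> {v}" using e2 by auto
      then have "card e \<le> 1" using card_mono[of "{v}" e] by simp
      then show False using e2 by simp
    qed
    have "H \<subseteq> Pow V" using less.prems by (auto simp: simple_graph_def)
    then have finH: "finite H" using less.prems(1) by (meson finite_Pow_iff finite_subset)
    have "card (H - {e}) < card (V - {v})"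
    proof (rule less.hyps)
      show "card (V - {v}) < card V" using v less.prems(1) by (rule card_Diff1_less[rotated])
      show "simple_graph (V - {v}) (H - {e})"
        using less.prems(3) ve by (auto simp: simple_graph_def)
      show "\<nexists>c. is_cycle (H - {e}) c" using less.prems(4) is_cycle_mono[of "H - {e}" _ H] by blast
    qed (use less.prems ne in auto)
    then show ?thesis using e v finH less.prems(1) by (simp add: card_Diff_singleton) 
  qed
qed

section \<open>Plane drawings\<close>

text \<open>In the application \<open>S\<close> is a drawing and the curve consists of a path in
  \<open>S\<close> and one new edge. The Jordan curve theorem cuts the face \<open>F\<close>
  containing the new edge into two parts, Janiszewski's theorem keeps each part connected, and all
  other faces miss the curve. That \<open>A\<close> and \<open>B\<close> are not old components
  makes the count exact.\<close>

lemma components_Jordan_split: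
  fixes S :: "complex set" and c :: "real \<Rightarrow> complex"
  assumes S: "compact S" and c: "simple_path c" "pathfinish c = pathstart c"
    and conn: "connected (S \<inter> path_image c)"
    and rest: "connected (path_image c - S)" "path_image c - S \<noteq> {}"
  obtains F A B where "F \<in> components (- S)" "path_image c - S \<subseteq> F" "A \<noteq> B"
    "A \<notin> components (- S)" "B \<notin> components (- S)"
    "components (- (S \<union> path_image c)) = (components (- S) - {F}) \<union> {A, B}"
proof -
  let ?T = "path_image c"
  have T: "compact ?T" using c by (simp add: compact_simple_path_image)
  have op: "open (- S)" using S by (simp add: compact_imp_closed open_Compl)
  note J = Jordan_inside_outside[OF c]
  obtain q where q: "q \<in> ?T" "q \<notin> S" using rest by blast
  define F where "F = connected_component_set (- S) q"
  have F: "F \<in> components (- S)" using q by (auto simp: F_def componentsI)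
  have oF: "open F" "connected F" "F \<subseteq> - S" "q \<in> F"
    using op q by (auto simp: F_def open_connected_component connected_component_subset
        connected_component_refl_eq)
  have TF: "?T - S \<subseteq> F"
    unfolding F_def using rest q by (intro connected_component_maximal) auto
  have maxF: "X \<subseteq> F" if "connected X" "X \<subseteq> - S" "X \<inter> F \<noteq> {}" for X
    using components_maximal[OF F] that by blast
  \<comment> \<open>Treats the inside and the outside of the curve at once; \<open>I\<close> stands
    for either.\<close>
  have part: "F \<inter> I \<in> components (- (S \<union> ?T)) \<and> F \<inter> I \<notin> components (- S)"
    if I: "connected I" "open I" "frontier I = ?T" "I \<inter> ?T = {}" for I
  proof -
    \<comment> \<open>\<open>F\<close> is an open neighbourhood of \<open>q\<close>, a point of the
      curve and hence of the closure of \<open>I\<close>, so \<open>F\<close> meets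
      \<open>I\<close>.\<close>
    have "q \<in> closure I" using q I(3) by (auto simp: frontier_def)
    then obtain a where a: "a \<in> F \<inter> I" using oF by (metis Int_emptyI open_Int_closure_eq_empty disjoint_iff equals0I IntI)
    define C where "C = connected_component_set (- (S \<union> ?T)) a"
    have aC: "a \<in> C" "connected C" "C \<subseteq> - (S \<union> ?T)"
      using a oF I connected_component_subset[of "- (S \<union> ?T)" a]
      by (auto simp: C_def connected_component_refl_eq simp del: Compl_Un)
    have CF: "C \<subseteq> F" using aC a by (intro maxF) auto
    have CI: "C \<subseteq> I"
    proof (rule ccontr)
      assume "\<not> C \<subseteq> I"
      then have "C \<inter> frontier I \<noteq> {}" using aC a by (intro connected_Int_frontier) auto
      then show False using I aC by auto
    qed
    have "F \<inter> I \<subseteq> C"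
    proof
      fix b assume b: "b \<in> F \<inter> I"
      \<comment> \<open>\<open>F\<close> joins \<open>a\<close> to \<open>b\<close> off
        \<open>S\<close> and \<open>I\<close> joins them off the curve. As \<open>S\<close> meets
        the curve in a connected set, the union does not separate them either.\<close>
      have "connected_component (- (S \<union> ?T)) a b"
      proof (rule Janiszewski[OF S _ conn])
        show "closed ?T" using T compact_imp_closed by blast
        show "connected_component (- S) a b"
          using a b oF unfolding connected_component_def by blast
        show "connected_component (- ?T) a b"
          using a b I unfolding connected_component_def by blast
      qed
      then show "b \<in> C" by (simp add: C_def)
    qed
    then have FI: "F \<inter> I = C" using CF CI by auto
    \<comment> \<open>\<open>q\<close> lies in \<open>F\<close> but not in \<open>I\<close>; an old
      component meeting \<open>F\<close> would have to be \<open>F\<close> itself.\<close>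
    have "F \<inter> I \<noteq> F" using oF q I by auto
    moreover have "F \<inter> I = F" if "F \<inter> I \<in> components (- S)"
      using components_nonoverlap[OF that F] a by auto
    ultimately have "F \<inter> I \<notin> components (- S)" by blast
    moreover have "C \<in> components (- (S \<union> ?T))"
      unfolding C_def using aC by (intro componentsI) auto
    ultimately show ?thesis using FI by simp
  qed
  let ?A = "F \<inter> inside ?T" and ?B = "F \<inter> outside ?T"
  have A: "?A \<in> components (- (S \<union> ?T)) \<and> ?A \<notin> components (- S)"
    using J inside_no_overlap[of ?T] by (intro part) auto
  have B: "?B \<in> components (- (S \<union> ?T)) \<and> ?B \<notin> components (- S)"
    using J outside_no_overlap[of ?T] by (intro part) auto
  have AB: "?A \<noteq> ?B" using A in_components_nonempty inside_Int_outside[of ?T] by blast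
  have other: "K \<in> components (- (S \<union> ?T))" if K: "K \<in> components (- S)" "K \<noteq> F" for K
  proof -
    have "K \<inter> F = {}" using components_nonoverlap[OF K(1) F] K(2) by auto
    then have KT: "K \<subseteq> - (S \<union> ?T)" using TF in_components_subset[OF K(1)] by auto
    show ?thesis
      unfolding in_components_maximal
    proof (intro conjI allI impI)
      show "K \<noteq> {}" "connected K" using K in_components_nonempty in_components_connected by auto
      fix d assume "d \<noteq> {} \<and> K \<subseteq> d \<and> d \<subseteq> - (S \<union> ?T) \<and> connected d"
      then show "d = K" using K(1) unfolding in_components_maximal by blast
    qed (use KT in auto)
  qed
  have conv: "K \<in> (components (- S) - {F}) \<union> {?A, ?B}" if K: "K \<in> components (- (S \<union> ?T))" for K
  proof -
    have Kc: "connected K" "K \<noteq> {}" "K \<subseteq> - (S \<union> ?T)"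
      using K in_components_connected in_components_nonempty in_components_subset by blast+
    then obtain a where a: "a \<in> K" by blast
    define L where "L = connected_component_set (- S) a"
    have L: "L \<in> components (- S)" "a \<in> L" "K \<subseteq> L"
      using a Kc by (auto simp: L_def componentsI connected_component_maximal connected_component_refl_eq)
    show ?thesis
    proof (cases "L = F")
      case False
      then have "K = L" using components_nonoverlap[OF K other[OF L(1) False]] a L by auto
      then show ?thesis using L False by auto
    next
      case True
      have "a \<in> inside ?T \<or> a \<in> outside ?T" using a Kc inside_Un_outside[of ?T] by blast
      then have "a \<in> ?A \<or> a \<in> ?B" using L True by auto
      then show ?thesis
        using components_nonoverlap[OF K conjunct1[OF A]] components_nonoverlap[OF K conjunct1[OF B]] a by auto
    qed
  qed
  show ?thesis
    by (rule that[OF F TF AB conjunct2[OF A] conjunct2[OF B]]) (use A B other conv in auto)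
qed


section \<open>Drawings of subgraphs and their faces\<close>

locale plane_drawing =
  fixes V :: "'a set" and E :: "'a set set" and p :: "'a \<Rightarrow> complex"
    and \<gamma> :: "'a set \<Rightarrow> real \<Rightarrow> complex"
  assumes finite_V: "finite V" and simple: "simple_graph V E"
    and inj: "inj_on p V"
    and arc_edge: "e \<in> E \<Longrightarrow> arc (\<gamma> e)"
    and ends_edge: "e \<in> E \<Longrightarrow> {pathstart (\<gamma> e), pathfinish (\<gamma> e)} = p ` e"
    and vertices_edge: "e \<in> E \<Longrightarrow> path_image (\<gamma> e) \<inter> p ` V = p ` e"
    and crossing: "e \<in> E \<Longrightarrow> f \<in> E \<Longrightarrow> e \<noteq> f \<Longrightarrow>
      path_image (\<gamma> e) \<inter> path_image (\<gamma> f) \<subseteq> p ` V"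
begin

text \<open>Only the arcs of edges are drawn; an isolated vertex contributes no point.\<close>

definition drawing :: "'a set set \<Rightarrow> complex set" where
  "drawing H = (\<Union>e\<in>H. path_image (\<gamma> e))"

abbreviation faces :: "'a set set \<Rightarrow> complex set set" where
  "faces H \<equiv> components (- drawing H)"

lemma finite_E: "finite E"
proof -
  have "E \<subseteq> Pow V" using simple by (auto simp: simple_graph_def)
  then show ?thesis using finite_V by (meson finite_Pow_iff finite_subset)
qed

lemma edge_subset: "e \<in> E \<Longrightarrow> e \<subseteq> V"
  using simple by (simp add: simple_graph_def)

lemma simple_graph_subset: "H \<subseteq> E \<Longrightarrow> simple_graph V H"
  using simple by (auto simp: simple_graph_def)

lemma drawing_insert: "drawing (insert e H) = drawing H \<union> path_image (\<gamma> e)"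
  by (auto simp: drawing_def)

lemma compact_drawing:
  assumes "H \<subseteq> E"
  shows "compact (drawing H)"
  unfolding drawing_def using assms finite_E finite_subset arc_edge
  by (intro compact_UN) (auto simp: compact_arc_image)

lemma vertex_in_edge_image:
  assumes "e \<in> E" "v \<in> V" "p v \<in> path_image (\<gamma> e)"
  shows "v \<in> e"
proof -
  have "p v \<in> p ` e" using vertices_edge[OF assms(1)] assms by auto
  then show ?thesis using inj edge_subset[OF assms(1)] assms(2) by (meson inj_on_image_mem_iff)
qed

lemma edge_image_Int_drawing:
  assumes "e \<in> E" "H \<subseteq> E" "e \<notin> H"
  shows "path_image (\<gamma> e) \<inter> drawing H \<subseteq> p ` e"
proof -
  have "path_image (\<gamma> e) \<inter> drawing H \<subseteq> path_image (\<gamma> e) \<inter> p ` V"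
    using crossing[OF assms(1)] assms(2,3) unfolding drawing_def by blast
  then show ?thesis using vertices_edge[OF assms(1)] by simp
qed

lemma edge_arc:
  assumes "{x, y} \<in> E" "x \<noteq> y"
  obtains g where "arc g" "pathstart g = p x" "pathfinish g = p y"
    "path_image g = path_image (\<gamma> {x, y})"
proof -
  let ?g = "\<gamma> {x, y}"
  have g: "arc ?g" "{pathstart ?g, pathfinish ?g} = {p x, p y}"
    using arc_edge[OF assms(1)] ends_edge[OF assms(1)] by auto
  then consider "pathstart ?g = p x" "pathfinish ?g = p y" | "pathstart ?g = p y" "pathfinish ?g = p x"
    by (auto simp: doubleton_eq_iff)
  then show ?thesis
  proof cases
    case 1 then show ?thesis using that g by blast
  next
    case 2 then show ?thesis using that[of "reversepath ?g"] g by (simp add: arc_reversepath)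
  qed
qed

text \<open>The arcs of the edges are joined one after another. Restricting the image to edges
  inside \<open>set xs\<close> strengthens the induction: it keeps \<open>p x\<close> off the arc of
  the tail, so the first arc meets it in \<open>p y\<close> only.\<close>

lemma graph_path_arc:
  assumes "graph_path H xs" "H \<subseteq> E" "length xs \<ge> 2"
  shows "\<exists>g. arc g \<and> pathstart g = p (hd xs) \<and> pathfinish g = p (last xs) \<and>
    path_image g \<subseteq> drawing {e \<in> H. e \<subseteq> set xs}"
  using assms
proof (induction xs rule: induct_list012)
  case (3 x y zs)
  have xy: "{x, y} \<in> H" "x \<noteq> y" "x \<notin> set (y # zs)" and tl: "graph_path H (y # zs)"
    using "3.prems" by (auto simp: graph_path_def)
  then have xyE: "{x, y} \<in> E" using "3.prems" by blast
  obtain g where g: "arc g" "pathstart g = p x" "pathfinish g = p y"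
    "path_image g = path_image (\<gamma> {x, y})" using edge_arc[OF xyE xy(2)] .
  have gd: "path_image g \<subseteq> drawing {e \<in> H. e \<subseteq> set (x # y # zs)}"
    using xy(1) g(4) unfolding drawing_def by auto
  show ?case
  proof (cases "zs = []")
    case True
    then show ?thesis using g gd by (intro exI[of _ g]) simp
  next
    case False
    then have "length (y # zs) \<ge> 2" by (cases zs) auto
    then obtain h where h: "arc h" "pathstart h = p y" "pathfinish h = p (last (y # zs))"
      "path_image h \<subseteq> drawing {e \<in> H. e \<subseteq> set (y # zs)}"
      using "3.IH"(2)[OF tl "3.prems"(2)] by auto
    have "path_image g \<inter> path_image h \<subseteq> {pathstart h}"
    proof
      fix q assume q: "q \<in> path_image g \<inter> path_image h"
      let ?K = "{e \<in> H. e \<subseteq> set (y # zs)}"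
      have "path_image g \<inter> drawing ?K \<subseteq> p ` {x, y}"
        unfolding g(4) using xy "3.prems"(2) by (intro edge_image_Int_drawing[OF xyE]) auto
      then have "q = p x \<or> q = p y" using q h(4) by auto
      moreover have "p x \<notin> drawing ?K"
      proof
        assume "p x \<in> drawing ?K"
        then obtain f where f: "f \<in> H" "f \<subseteq> set (y # zs)" "p x \<in> path_image (\<gamma> f)"
          unfolding drawing_def by blast
        have "f \<in> E" "x \<in> V" using f(1) "3.prems"(2) edge_subset[OF xyE] by auto
        then have "x \<in> f" using f(3) by (rule vertex_in_edge_image)
        then show False using f(2) xy(3) by blast
      qed
      ultimately show "q \<in> {pathstart h}" using q h by auto
    qed
    then have "arc (g +++ h)" using g h by (intro arc_join) auto
    moreover have "path_image (g +++ h) = path_image g \<union> path_image h"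
      using g h by (simp add: path_image_join)
    moreover have "drawing {e \<in> H. e \<subseteq> set (y # zs)} \<subseteq> drawing {e \<in> H. e \<subseteq> set (x # y # zs)}"
      unfolding drawing_def by auto
    ultimately show ?thesis using g gd h False by (intro exI[of _ "g +++ h"]) auto
  qed
qed auto

text \<open>The arc of \<open>e\<close> and an arc along the path in \<open>H\<close> form a Jordan
  curve, to which \<open>components_Jordan_split\<close> applies with the drawing of
  \<open>H\<close> as \<open>S\<close>.\<close>

lemma faces_split:
  assumes e: "e \<in> E" "e \<notin> H" and H: "H \<subseteq> E"
    and xs: "graph_path H xs" "length xs \<ge> 2" "e = {hd xs, last xs}"
  obtains F A B where "F \<in> faces H" "path_image (\<gamma> e) - p ` V \<subseteq> F" "A \<noteq> B"
    "A \<notin> faces H" "B \<notin> faces H" "faces (insert e H) = (faces H - {F}) \<union> {A, B}"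
proof -
  have "e \<subseteq> V" "card e = 2" using e simple by (auto simp: simple_graph_def)
  then have ne: "hd xs \<noteq> last xs" using xs(3) by auto
  obtain g where g: "arc g" "pathstart g = p (hd xs)" "pathfinish g = p (last xs)"
    "path_image g \<subseteq> drawing {e \<in> H. e \<subseteq> set xs}" using graph_path_arc[OF xs(1) H xs(2)] by blast
  then have gH: "path_image g \<subseteq> drawing H" by (auto simp: drawing_def)
  have "{last xs, hd xs} \<in> E" using e xs(3) by (simp add: insert_commute)
  then obtain h where h: "arc h" "pathstart h = p (last xs)" "pathfinish h = p (hd xs)"
    "path_image h = path_image (\<gamma> {last xs, hd xs})" using edge_arc ne by metis
  then have he: "path_image h = path_image (\<gamma> e)" using xs(3) by (simp add: insert_commute)
  have hH: "path_image h \<inter> drawing H \<subseteq> p ` e" unfolding he using e H by (intro edge_image_Int_drawing)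
  have pe: "p ` e = {p (hd xs), p (last xs)}" using xs(3) by simp
  have peg: "p ` e \<subseteq> path_image g" using pe g pathstart_in_path_image[of g] pathfinish_in_path_image[of g] by auto
  let ?c = "g +++ h"
  have c: "simple_path ?c" using g h hH gH pe by (intro simple_path_join_loop) auto
  have loop: "pathfinish ?c = pathstart ?c" using g h by simp
  have img: "path_image ?c = path_image g \<union> path_image h" using g h by (simp add: path_image_join)
  \<comment> \<open>The arc of \<open>e\<close> meets the drawing of \<open>H\<close> at its ends
    only, and these lie on \<open>g\<close>. So the common part is the arc \<open>g\<close>, and the
    rest of the curve is the arc of \<open>e\<close> without its ends; both are connected.\<close>
  have int: "drawing H \<inter> path_image ?c = path_image g" using img gH hH peg by auto
  have diff: "path_image ?c - drawing H = path_image h - {pathstart h, pathfinish h}"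
    using img gH hH peg h pe by auto
  have un: "drawing H \<union> path_image ?c = drawing (insert e H)"
    unfolding img drawing_insert he using gH by auto
  have sh: "simple_path h" using h arc_imp_simple_path by blast
  have "connected (drawing H \<inter> path_image ?c)" unfolding int using g by (simp add: connected_arc_image)
  moreover have "connected (path_image ?c - drawing H)" "path_image ?c - drawing H \<noteq> {}"
    unfolding diff using connected_simple_path_endless[OF sh] nonempty_simple_path_endless[OF sh] by auto
  moreover have sub: "path_image (\<gamma> e) - p ` V \<subseteq> path_image ?c - drawing H"
    unfolding diff he[symmetric] using h pe \<open>e \<subseteq> V\<close> by auto
  ultimately obtain F A B where "F \<in> faces H" "path_image ?c - drawing H \<subseteq> F"
    "A \<noteq> B" "A \<notin> faces H" "B \<notin> faces H"
    "components (- (drawing H \<union> path_image ?c)) = (faces H - {F}) \<union> {A, B}"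
    by (metis components_Jordan_split[OF compact_drawing[OF H] c loop])
  then show ?thesis using sub unfolding un by (intro that[of F A B]) auto
qed

text \<open>Induction removing the edge at a leaf \<open>v\<close>. Its arc does not separate the
  plane and meets the remaining drawing in at most the point of the other end, so Janiszewski's
  theorem applies.\<close>

lemma connected_Compl_drawing_acyclic:
  assumes "H \<subseteq> E" "\<nexists>c. is_cycle H c"
  shows "connected (- drawing H)"
  using finite_subset[OF assms(1) finite_E] assms
proof (induction H rule: finite_psubset_induct)
  case (psubset H)
  show ?case
  proof (cases "H = {}")
    case True then show ?thesis by (simp add: drawing_def connected_UNIV)
  next
    case False
    then obtain v e where ve: "{f \<in> H. v \<in> f} = {e}"
      using acyclic_has_leaf[OF finite_V simple_graph_subset[OF psubset.prems(1)]] psubset.prems(2) by blast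
    then have e: "e \<in> H" "v \<in> e" by auto
    have eE: "e \<in> E" using e psubset.prems by auto
    have vV: "v \<in> V" using e edge_subset[OF eE] by auto
    have "card e = 2" using eE simple by (auto simp: simple_graph_def)
    then obtain u where u: "e = {v, u}" using e by (auto simp: card_2_iff)
    let ?S = "drawing (H - {e})" and ?T = "path_image (\<gamma> e)"
    have "p v \<notin> ?S"
    proof
      assume "p v \<in> ?S"
      then obtain f where f: "f \<in> H - {e}" "p v \<in> path_image (\<gamma> f)" by (auto simp: drawing_def)
      then have "f \<in> E" using psubset.prems(1) by blast
      then have "v \<in> f" using vV f(2) by (rule vertex_in_edge_image)
      then have "f \<in> {f \<in> H. v \<in> f}" using f(1) by blast
      then show False unfolding ve using f(1) by blast
    qed
    moreover have "?T \<inter> ?S \<subseteq> p ` e" using psubset.prems by (intro edge_image_Int_drawing[OF eE]) auto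
    ultimately have "?S \<inter> ?T \<subseteq> {p u}" using u by auto
    then have "connected (?S \<inter> ?T)" by (metis connected_empty connected_sing subset_singletonD)
    moreover have "compact ?S" using psubset.prems by (intro compact_drawing) auto
    moreover have "closed ?T" using arc_edge[OF eE] by (simp add: closed_arc_image)
    moreover have "connected (- ?S)"
      using e(1) psubset.prems is_cycle_mono[of "H - {e}" _ H] by (intro psubset.IH) blast+
    moreover have "connected (- ?T)" using arc_edge[OF eE] by (intro connected_arc_complement) auto
    ultimately have "connected (- (?S \<union> ?T))" by (intro Janiszewski_connected)
    moreover have "?S \<union> ?T = drawing H" using e drawing_insert[of e "H - {e}"] by (simp add: insert_absorb)
    ultimately show ?thesis by simp
  qed
qed

section \<open>Face boundaries and incidences of edges with faces\<close>

lemma edge_image_not_subset_finite: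
  assumes "e \<in> E" "finite X"
  shows "\<not> path_image (\<gamma> e) \<subseteq> X"
proof
  assume "path_image (\<gamma> e) \<subseteq> X"
  then have "finite (path_image (\<gamma> e))" using assms(2) finite_subset by blast
  moreover have "inj_on (\<gamma> e) {0..1}" using arc_edge[OF assms(1)] by (simp add: arc_def)
  ultimately have "finite {0..1::real}" unfolding path_image_def using finite_imageD by blast
  then show False by (simp add: infinite_Icc)
qed

text \<open>Contact at vertices is discounted because a face may touch an end of an edge without
  lying along that edge.\<close>

definition boundary_edges :: "complex set \<Rightarrow> 'a set set" where
  "boundary_edges F = {e \<in> E. \<not> path_image (\<gamma> e) \<inter> closure F \<subseteq> p ` V}"

text \<open>If the boundary edges formed a forest, the complement of their drawing minus the
  vertices would be connected and miss the frontier of \<open>F\<close>, hence lie in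
  \<open>F\<close>. No room would remain for further edges, so the whole graph would be that forest
  and would not separate the plane.\<close>

lemma boundary_edges_cycle:
  assumes F: "F \<in> faces E" and nc: "\<not> connected (- drawing E)"
  shows "\<exists>c. is_cycle (boundary_edges F) c"
proof (rule ccontr)
  let ?H = "boundary_edges F"
  have HE: "?H \<subseteq> E" by (auto simp: boundary_edges_def)
  assume "\<nexists>c. is_cycle ?H c"
  then have "connected (- drawing ?H)" using HE by (intro connected_Compl_drawing_acyclic)
  moreover have "open (- drawing ?H)" using compact_drawing[OF HE] by (simp add: compact_imp_closed open_Compl)
  ultimately have conn: "connected (- drawing ?H - p ` V)"
    using finite_V by (intro connected_open_delete_finite) auto
  have Fs: "F \<subseteq> - drawing E" "F \<noteq> {}" using F in_components_subset in_components_nonempty by blast+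
  have op: "open (- drawing E)" using compact_drawing[of E] by (simp add: compact_imp_closed open_Compl)
  have oF: "open F" using F op open_components by blast
  have fr: "frontier F \<subseteq> drawing ?H \<union> p ` V"
  proof
    fix q assume q: "q \<in> frontier F"
    \<comment> \<open>A frontier point off the drawing would lie in an open face meeting
      \<open>F\<close>, hence in \<open>F\<close>, which is open and so contains none of its
      frontier points.\<close>
    have "q \<in> drawing E"
    proof (rule ccontr)
      assume nq: "q \<notin> drawing E"
      define K where "K = connected_component_set (- drawing E) q"
      have K: "K \<in> faces E" "open K" "q \<in> K"
        using nq op by (auto simp: K_def componentsI open_connected_component connected_component_refl_eq)
      have "q \<in> closure F" "q \<notin> F" using q oF by (auto simp: frontier_def interior_open)
      then have "K \<inter> F \<noteq> {}" using K open_Int_closure_eq_empty[of K F] by auto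
      then have "K = F" using components_nonoverlap[OF K(1) F] by auto
      then show False using K \<open>q \<notin> F\<close> by auto
    qed
    then obtain e where "e \<in> E" "q \<in> path_image (\<gamma> e)" by (auto simp: drawing_def)
    then show "q \<in> drawing ?H \<union> p ` V"
      using q by (auto simp: drawing_def boundary_edges_def frontier_def)
  qed
  have sub: "- drawing ?H - p ` V \<subseteq> F"
  proof (rule ccontr)
    assume a: "\<not> - drawing ?H - p ` V \<subseteq> F"
    have "drawing ?H \<subseteq> drawing E" using HE by (auto simp: drawing_def)
    have "infinite F" using oF Fs(2) finite_imp_not_open by blast
    then have "F - p ` V \<noteq> {}" using finite_V by (metis finite.emptyI finite_Diff2 finite_imageI)
    then have "(- drawing ?H - p ` V) \<inter> F \<noteq> {}" using Fs \<open>drawing ?H \<subseteq> drawing E\<close> by auto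
    then have "(- drawing ?H - p ` V) \<inter> frontier F \<noteq> {}"
      using a by (intro connected_Int_frontier[OF conn]) auto
    then show False using fr by auto
  qed
  \<comment> \<open>The arc of a further edge avoids \<open>F\<close>, hence lies in the drawing of
    \<open>?H\<close> together with the vertices; it meets that drawing at its ends only, so it
    would be finite.\<close>
  have "?H = E"
  proof (rule ccontr)
    assume "?H \<noteq> E"
    then obtain e where e: "e \<in> E" "e \<notin> ?H" using HE by auto
    have "path_image (\<gamma> e) \<inter> F = {}" using Fs e by (auto simp: drawing_def)
    then have "path_image (\<gamma> e) \<subseteq> (path_image (\<gamma> e) \<inter> drawing ?H) \<union> p ` V" using sub by auto
    then have "path_image (\<gamma> e) \<subseteq> p ` e \<union> p ` V" using edge_image_Int_drawing[OF e(1) HE e(2)] by blast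
    then have "path_image (\<gamma> e) \<subseteq> p ` V" using edge_subset[OF e(1)] by blast
    then show False using edge_image_not_subset_finite[OF e(1)] finite_V by blast
  qed
  then show False using \<open>connected (- drawing ?H)\<close> nc by simp
qed

text \<open>The edges lying on a cycle, described by the bypass that \<open>faces_split\<close>
  takes.\<close>

definition cyclic_edges :: "'a set set" where
  "cyclic_edges = {e \<in> E. \<exists>xs. graph_path (E - {e}) xs \<and> length xs \<ge> 2 \<and> e = {hd xs, last xs}}"

text \<open>Putting \<open>e\<close> back splits one face \<open>F\<close> of \<open>E - {e}\<close>
  into \<open>A\<close> and \<open>B\<close>. A face with \<open>e\<close> on its boundary meets the
  open set \<open>F\<close>, so it is none of the undivided faces.\<close>

lemma card_faces_at_cyclic_edge:
  assumes "e \<in> cyclic_edges"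
  shows "card {F \<in> faces E. e \<in> boundary_edges F} \<le> 2"
proof -
  from assms obtain xs where e: "e \<in> E" and xs: "graph_path (E - {e}) xs" "length xs \<ge> 2" "e = {hd xs, last xs}"
    by (auto simp: cyclic_edges_def)
  obtain F A B where F: "F \<in> faces (E - {e})" "path_image (\<gamma> e) - p ` V \<subseteq> F"
    and fc: "faces (insert e (E - {e})) = (faces (E - {e}) - {F}) \<union> {A, B}"
    using faces_split[OF e _ _ xs] by (metis Diff_subset insertCI DiffD2)
  have "{K \<in> faces E. e \<in> boundary_edges K} \<subseteq> {A, B}"
  proof
    fix K assume "K \<in> {K \<in> faces E. e \<in> boundary_edges K}"
    then have K: "K \<in> faces E" and "e \<in> boundary_edges K" by auto
    then obtain q where q: "q \<in> path_image (\<gamma> e) - p ` V" "q \<in> closure K"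
      by (auto simp: boundary_edges_def)
    have "open (- drawing (E - {e}))" using compact_drawing[of "E - {e}"]
      by (simp add: compact_imp_closed open_Compl)
    then have "open F" using F(1) open_components by blast
    then have ne: "F \<inter> K \<noteq> {}" using q F open_Int_closure_eq_empty[of F K] by auto
    have "K \<in> (faces (E - {e}) - {F}) \<union> {A, B}" using K fc e by (simp add: insert_absorb)
    moreover have "K = F" if "K \<in> faces (E - {e})" using components_nonoverlap[OF that F(1)] ne by auto
    ultimately show "K \<in> {A, B}" by auto
  qed
  then have "card {K \<in> faces E. e \<in> boundary_edges K} \<le> card {A, B}" by (intro card_mono) auto
  also have "\<dots> \<le> 2" by (simp add: card_insert_if)
  finally show ?thesis .
qed

text \<open>Euler's formula with a maximal forest in place of the number of components: the forest
  has one face, and each remaining edge adds exactly one.\<close>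

lemma card_faces_forest:
  assumes M: "M \<subseteq> E" "\<nexists>c. is_cycle M c"
    and mx: "\<And>e. e \<in> E - M \<Longrightarrow> \<exists>c. is_cycle (insert e M) c"
  shows "finite (faces E) \<and> card (faces E) = Suc (card (E - M))"
proof -
  have "finite (E - M)" "E - M \<subseteq> E - M" using finite_E by auto
  then have "finite (faces (M \<union> (E - M))) \<and> card (faces (M \<union> (E - M))) = Suc (card (E - M))"
  proof (induction rule: finite_subset_induct')
    case empty
    have "- drawing M \<noteq> {}"
    proof
      assume "- drawing M = {}"
      then have "drawing M = UNIV" by blast
      then show False
        using compact_imp_bounded[OF compact_drawing[OF M(1)]] not_bounded_UNIV by metis
    qed
    then have "faces M = {- drawing M}"
      using connected_Compl_drawing_acyclic[OF M] by (simp add: components_eq_sing_iff)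
    then show ?case by simp
  next
    case (insert e N)
    \<comment> \<open>The cycle must use \<open>e\<close>, as \<open>M\<close> has none; its bypass
      stays in \<open>M\<close> and so is present whichever edges were added before.\<close>
    obtain c where c: "is_cycle (insert e M) c" using mx[of e] insert.hyps by blast
    then obtain i where i: "i < length c" "{c ! i, c ! (Suc i mod length c)} \<notin> M"
      using M(2) unfolding is_cycle_def by blast
    then have ei: "{c ! i, c ! (Suc i mod length c)} = e" using c unfolding is_cycle_def by blast
    obtain xs where xs: "graph_path (insert e M - {e}) xs" "length xs \<ge> 2" "e = {hd xs, last xs}"
      using cycle_edge_bypass[OF c i(1)] unfolding ei by blast
    have xsN: "graph_path (M \<union> N) xs" using xs(1) by (rule graph_path_mono) auto
    have e: "e \<in> E" "e \<notin> M \<union> N" "M \<union> N \<subseteq> E" using insert.hyps M(1) by blast+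
    obtain F A B where F: "F \<in> faces (M \<union> N)" and "path_image (\<gamma> e) - p ` V \<subseteq> F"
      and AB: "A \<noteq> B" "A \<notin> faces (M \<union> N)" "B \<notin> faces (M \<union> N)"
      and fc: "faces (insert e (M \<union> N)) = (faces (M \<union> N) - {F}) \<union> {A, B}"
      by (rule faces_split[OF e xsN xs(2,3)])
    have fin: "finite (faces (M \<union> N))" and cd: "card (faces (M \<union> N)) = Suc (card N)" using insert.IH by auto
    have "card (faces (M \<union> N) - {F}) = card N" using fin F cd by simp
    moreover have "card ((faces (M \<union> N) - {F}) \<union> {A, B}) = card (faces (M \<union> N) - {F}) + card {A, B}"
      using fin AB by (intro card_Un_disjoint) auto
    ultimately have "card (faces (insert e (M \<union> N))) = Suc (Suc (card N))" using AB(1) fc by simp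
    moreover have "finite (faces (insert e (M \<union> N)))" using fc fin by simp
    ultimately show ?case using insert.hyps by simp
  qed
  moreover have "M \<union> (E - M) = E" using M(1) by auto
  ultimately show ?thesis by simp
qed

text \<open>Combines \<open>card E + 2 \<le> card V + card (faces E)\<close> with a double count of
  incidences between faces and cyclic edges, at least \<open>g\<close> per face and at most 2 per
  edge. The additive form avoids subtraction on naturals.\<close>

lemma card_edges_girth:
  assumes cyc: "is_cycle E c0" and g: "\<And>c. is_cycle E c \<Longrightarrow> g \<le> length c"
  shows "g * card E + 2 * g \<le> g * card V + 2 * card E"
proof -
  define \<M> where "\<M> = {M. M \<subseteq> E \<and> (\<nexists>c. is_cycle M c)}"
  have "\<not> is_cycle {} c" for c :: "'a list" unfolding is_cycle_iff_graph_path by blast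
  then have "{} \<in> \<M>" by (simp add: \<M>_def)
  moreover have "finite \<M>" by (rule finite_subset[of _ "Pow E"]) (use finite_E in \<open>auto simp: \<M>_def\<close>)
  ultimately obtain M where M: "M \<in> \<M>" and mx: "\<And>M'. M' \<in> \<M> \<Longrightarrow> M \<subseteq> M' \<Longrightarrow> M = M'"
    using finite_has_maximal2 by metis
  have M': "M \<subseteq> E" "\<nexists>c. is_cycle M c" using M by (auto simp: \<M>_def)
  have "\<exists>c. is_cycle (insert e M) c" if "e \<in> E - M" for e
    using mx[of "insert e M"] that M' by (auto simp: \<M>_def)
  then have fin: "finite (faces E)" and cF: "card (faces E) = Suc (card (E - M))"
    using card_faces_forest[OF M'] by blast+
  have finM: "finite M" using M'(1) finite_E finite_subset by blast
  have "length c0 \<ge> 3" "{c0 ! 0, c0 ! (Suc 0 mod length c0)} \<in> E" using cyc unfolding is_cycle_def by force+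
  then have ne: "V \<noteq> {}" using edge_subset by blast
  have MV: "card M < card V"
    using ne M' by (intro card_edges_acyclic_less[OF finite_V]) (auto intro: simple_graph_subset)
  \<comment> \<open>As the graph has a cycle, some edge lies outside \<open>M\<close>. Hence there
    are at least two faces, as \<open>boundary_edges_cycle\<close> demands.\<close>
  have "M \<noteq> E" using M'(2) cyc by auto
  then have "card (E - M) > 0" using M'(1) finite_E by (auto simp: card_gt_0_iff)
  then have F2: "card (faces E) \<noteq> 1" "faces E \<noteq> {}" using cF by auto
  have nc: "\<not> connected (- drawing E)"
  proof
    assume "connected (- drawing E)"
    moreover have "- drawing E \<noteq> {}" using F2(2) by auto
    ultimately have "faces E = {- drawing E}" by (simp add: components_eq_sing_iff)
    then show False using F2 by simp
  qed
  have finC: "finite cyclic_edges" "cyclic_edges \<subseteq> E"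
    using finite_E by (auto simp: cyclic_edges_def)
  have face: "g \<le> (\<Sum>e\<in>{e \<in> cyclic_edges. e \<in> boundary_edges F}. 1)" if F: "F \<in> faces E" for F
  proof -
    obtain c where c: "is_cycle (boundary_edges F) c" using boundary_edges_cycle[OF F nc] by blast
    then have cE: "is_cycle E c" by (rule is_cycle_mono) (simp add: boundary_edges_def)
    have "{c ! i, c ! (Suc i mod length c)} \<in> {e \<in> cyclic_edges. e \<in> boundary_edges F}"
      if "i < length c" for i
    proof -
      have "{c ! i, c ! (Suc i mod length c)} \<in> E" "{c ! i, c ! (Suc i mod length c)} \<in> boundary_edges F"
        using c cE that unfolding is_cycle_def by blast+
      then show ?thesis
        using cycle_edge_bypass[OF cE that] unfolding cyclic_edges_def by blast
    qed
    then have "(\<lambda>i. {c ! i, c ! (Suc i mod length c)}) ` {..<length c}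
        \<subseteq> {e \<in> cyclic_edges. e \<in> boundary_edges F}"
      by blast
    then have "length c \<le> card {e \<in> cyclic_edges. e \<in> boundary_edges F}"
      using card_mono[OF finite_subset[OF _ finC(1)]] card_cycle_edges[OF cE]
      by (metis (no_types, lifting) mem_Collect_eq subsetI)
    then show ?thesis using g[OF cE] by simp
  qed
  have "g * card (faces E) \<le> (\<Sum>F\<in>faces E. \<Sum>e\<in>{e \<in> cyclic_edges. e \<in> boundary_edges F}. 1)"
    using sum_mono[OF face] by (simp add: mult.commute)
  also have "\<dots> = (\<Sum>e\<in>cyclic_edges. \<Sum>F\<in>{F \<in> faces E. e \<in> boundary_edges F}. 1)"
    by (rule sum.swap_restrict[OF fin finC(1)])
  also have "\<dots> \<le> (\<Sum>e\<in>cyclic_edges. 2)"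
    using card_faces_at_cyclic_edge by (intro sum_mono) simp
  also have "\<dots> \<le> 2 * card E" using card_mono[OF finite_E finC(2)] by simp
  finally have le: "g * card (faces E) \<le> 2 * card E" .
  have "card E = card M + card (E - M)"
    using M'(1) finM finite_E by (simp add: card_Diff_subset card_mono)
  \<comment> \<open>Of the 2 on the left, one comes from \<open>card M < card V\<close> and one from
    the single face of the forest.\<close>
  then have "card E + 2 \<le> card V + card (faces E)" using MV cF by linarith
  then have "g * (card E + 2) \<le> g * (card V + card (faces E))" by (rule mult_le_mono2)
  then show ?thesis using le by (simp add: algebra_simps)
qed

end

theorem theorem13:
  fixes V :: "'a set" and E :: "'a set set"
  assumes "finite V" and "V \<noteq> {}" and "simple_graph V E"
    and "planar V E"
    and "min_degree V E \<ge> 2"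
    and "girth E \<ge> 10"
  shows "indep_bondage_number V E \<le> 3"
proof -
  obtain p :: "'a \<Rightarrow> complex" and \<gamma> where inj: "inj_on p V"
    and edges: "\<forall>e\<in>E. arc (\<gamma> e) \<and> {pathstart (\<gamma> e), pathfinish (\<gamma> e)} = p ` e \<and>
      path_image (\<gamma> e) \<inter> p ` V = p ` e"
    and cross: "\<forall>e\<in>E. \<forall>f\<in>E. e \<noteq> f \<longrightarrow> path_image (\<gamma> e) \<inter> path_image (\<gamma> f) \<subseteq> p ` V"
    using assms(4) unfolding planar_def by blast
  interpret plane_drawing V E p \<gamma>
  proof
    show "finite V" "simple_graph V E" "inj_on p V" by fact+
  qed (use edges cross in simp_all)
  have len: "10 \<le> length c" if "is_cycle E c" for c
  proof -
    have "girth E \<le> enat (length c)" unfolding girth_def using that by (intro INF_lower) simp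
    with assms(6) have "10 \<le> enat (length c)" by (rule order_trans)
    then show ?thesis by (simp add: numeral_eq_enat)
  qed
  \<comment> \<open>With \<open>g = 10\<close> the girth bound reads
    \<open>8 * card E + 20 \<le> 10 * card V\<close>. It presupposes a cycle, so forests are treated
    apart.\<close>
  have sparse: "4 * card E < 5 * card V"
  proof (cases "\<exists>c. is_cycle E c")
    case True
    then obtain c where "is_cycle E c" ..
    from card_edges_girth[OF this len] show ?thesis by simp
  next
    case False
    then have "card E < card V" using assms by (intro card_edges_acyclic_less)
    then show ?thesis by simp
  qed
  have deg: "2 \<le> vertex_degree E v" if "v \<in> V" for v
  proof -
    have "min_degree V E \<le> vertex_degree E v"
      unfolding min_degree_def using assms(1) that by (intro Min_le) auto
    with assms(5) show ?thesis by simp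
  qed
  show ?thesis
  proof (cases "\<exists>u v. {u, v} \<in> E \<and> vertex_degree E u = 2 \<and> vertex_degree E v = 2")
    case True
    then show ?thesis using indep_bondage_number_le_adjacent_degree_two[OF assms(1,3)] by blast
  next
    case False
    then have no: "\<And>u v. {u, v} \<in> E \<Longrightarrow> vertex_degree E u = 2 \<Longrightarrow> vertex_degree E v \<noteq> 2" by blast
    have "\<exists>w. vertex_degree E w = 3 \<and> (\<forall>u. {w, u} \<in> E \<longrightarrow> vertex_degree E u = 2)"
      by (rule sparse_reducible_configuration[OF assms(1,3) _ sparse]) (use deg no in blast)+
    then obtain w where "vertex_degree E w = 3" "\<And>u. {w, u} \<in> E \<Longrightarrow> vertex_degree E u = 2" by blast
    then show ?thesis using indep_bondage_number_le_degree_three[OF assms(1,3)] no by blast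
  qed
qed

end
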